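(* Let $n\ge 1$. For $g_1,\dots,g_n\in\mathrm{SU}(2)$ define the quadratic form in $\lambda=(\lambda_1,\dots,\lambda_n)$ $$Q(\lambda_1,\dots,\lambda_n)=\det\Bigl(\sum_{j=1}^n\lambda_j g_j\Bigr).$$ Then: a) $(g_1,\dots,g_n)\mapsto Q$ gives a well-defined map from the double coset space $\Pi(n)$ to the space of quadratic forms in $n$ variables (i.e. $Q$ depends only on the class of $(g_1,\dots,g_n)$ in $\Pi(n)$). b) The coefficients of $Q$ are real, and for each $j$ the coefficient of $\lambda_j^2$ is $1$. c) $Q$ is positive semidefinite (on $\mathbb R^n$). d) The rank of $Q$ is at most $4$.
   Context: $\mathrm{SU}(2)$ is the group of unitary $2\times2$ complex matrices with determinant $1$. $G(n)=\mathrm{SU}(2)\times\dots\times\mathrm{SU}(2)$ ($n$ factors), and $K(n)=\{(h,\dots,h):h\in\mathrm{SU}(2)\}\subset G(n)$ is the diagonal subgroup. $\Pi(n)=K(n)\backslash G(n)/K(n)$ is the space of double cosets, i.e. the set of $n$-tuples $(g_1,\dots,g_n)\in G(n)$ modulo the equivalence $(g_1,\dots,g_n)\sim(hg_1q,\dots,hg_nq)$ for $h,q\in\mathrm{SU}(2)$. *)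

theory Defs
  imports "HOL-Analysis.Analysis" "HOL-Algebra.Product_Groups" "HOL-Library.Poly_Mapping"
begin

definition conj_transpose :: "complex ^ 'm ^ 'n \<Rightarrow> complex ^ 'n ^ 'm" where
  "conj_transpose A = (\<chi> i j. cnj (A $ j $ i))"

definition unitary_matrix :: "complex ^ 'n ^ 'n \<Rightarrow> bool" where
  "unitary_matrix A \<longleftrightarrow> conj_transpose A ** A = mat 1 \<and> A ** conj_transpose A = mat 1"

definition SU2 :: "(complex ^ 2 ^ 2) monoid" where
  "SU2 = \<lparr>carrier = {A. unitary_matrix A \<and> det A = 1}, mult = (**), one = mat 1\<rparr>"

lemma conj_transpose_mult: "conj_transpose (A ** B) = conj_transpose B ** conj_transpose A"
  by (simp add: conj_transpose_def matrix_matrix_mult_def vec_eq_iff mult.commute)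

lemma conj_transpose_conj_transpose [simp]: "conj_transpose (conj_transpose A) = A"
  by (simp add: conj_transpose_def vec_eq_iff)

lemma conj_transpose_one [simp]: "conj_transpose (mat 1) = mat 1"
  by (simp add: conj_transpose_def mat_def vec_eq_iff)

lemma unitary_matrix_mult: 
  assumes "unitary_matrix A" "unitary_matrix B"
  shows "unitary_matrix (A ** B)"
proof -
  have "conj_transpose B ** (conj_transpose A ** A) ** B = mat 1"
       "A ** (B ** conj_transpose B) ** conj_transpose A = mat 1"
    using assms by (simp_all add: unitary_matrix_def)
  then show ?thesis
    by (simp add: unitary_matrix_def conj_transpose_mult matrix_mul_assoc)
qed

lemma group_SU2: "group SU2"
proof (rule groupI)
  fix A assume A: "A \<in> carrier SU2"
  then have "det (conj_transpose A ** A) = 1"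
    by (simp add: SU2_def unitary_matrix_def)
  then have "det (conj_transpose A) * det A = 1"
    by (simp add: det_mul)
  with A have "det (conj_transpose A) = 1"
    by (simp add: SU2_def)
  with A show "\<exists>B\<in>carrier SU2. B \<otimes>\<^bsub>SU2\<^esub> A = \<one>\<^bsub>SU2\<^esub>"
    by (intro bexI[of _ "conj_transpose A"]) (auto simp: SU2_def unitary_matrix_def)
qed (auto simp: SU2_def unitary_matrix_mult det_mul matrix_mul_assoc unitary_matrix_def[of "mat 1"])

text \<open>The number of factors is the cardinality of the index type \<open>'n\<close>, which is finite and nonempty.\<close>

definition SU2_power :: "('n \<Rightarrow> complex ^ 2 ^ 2) monoid" where
  "SU2_power = product_group UNIV (\<lambda>_. SU2)"

lemma group_SU2_power: "group SU2_power"
  by (simp add: SU2_power_def group_SU2)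

definition diagonal_SU2 :: "('n \<Rightarrow> complex ^ 2 ^ 2) set" where
  "diagonal_SU2 = {(\<lambda>_. h) | h. h \<in> carrier SU2}"

lemma subgroup_diagonal_SU2: "subgroup (diagonal_SU2 :: ('n \<Rightarrow> complex ^ 2 ^ 2) set) SU2_power"
proof -
  interpret S: group SU2 by (rule group_SU2)
  interpret P: group "SU2_power :: ('n \<Rightarrow> complex ^ 2 ^ 2) monoid" by (rule group_SU2_power)
  show ?thesis
  proof (rule P.subgroupI)
    fix g :: "'n \<Rightarrow> complex ^ 2 ^ 2" assume "g \<in> diagonal_SU2"
    then obtain h where h: "g = (\<lambda>_. h)" "h \<in> carrier SU2"
      by (auto simp: diagonal_SU2_def)
    have "inv\<^bsub>SU2_power\<^esub> g = (\<lambda>_. inv\<^bsub>SU2\<^esub> h)"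
      by (rule P.inv_equality) (use h in \<open>auto simp: SU2_power_def\<close>)
    with h show "inv\<^bsub>SU2_power\<^esub> g \<in> diagonal_SU2"
      by (auto simp: diagonal_SU2_def)
  next
    show "(diagonal_SU2 :: ('n \<Rightarrow> complex ^ 2 ^ 2) set) \<noteq> {}"
      using S.one_closed by (auto simp: diagonal_SU2_def)
  qed (auto simp: diagonal_SU2_def SU2_power_def restrict_UNIV)
qed

definition double_coset_rel ::
    "(('n \<Rightarrow> complex ^ 2 ^ 2) \<times> ('n \<Rightarrow> complex ^ 2 ^ 2)) set" where
  "double_coset_rel = {(g, g'). g \<in> carrier SU2_power \<and> g' \<in> carrier SU2_power \<and>
     (\<exists>h\<in>diagonal_SU2. \<exists>q\<in>diagonal_SU2. g' = h \<otimes>\<^bsub>SU2_power\<^esub> g \<otimes>\<^bsub>SU2_power\<^esub> q)}"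

lemma equiv_double_coset_rel: "equiv (carrier SU2_power) double_coset_rel"
proof -
  interpret P: group SU2_power by (rule group_SU2_power)
  interpret D: subgroup diagonal_SU2 SU2_power by (rule subgroup_diagonal_SU2)
  show ?thesis
  proof (rule equivI)
    show "double_coset_rel \<subseteq> carrier SU2_power \<times> carrier SU2_power"
      by (auto simp: double_coset_rel_def)
    show "refl_on (carrier SU2_power) double_coset_rel"
      by (rule refl_onI)
        (auto simp: double_coset_rel_def intro!: bexI[of _ "\<one>\<^bsub>SU2_power\<^esub>"])
    show "sym double_coset_rel"
    proof (rule symI)
      fix a b assume "(a, b) \<in> double_coset_rel"
      then obtain h q where *: "a \<in> carrier SU2_power" "b \<in> carrier SU2_power"
          "h \<in> diagonal_SU2" "q \<in> diagonal_SU2" "b = h \<otimes>\<^bsub>SU2_power\<^esub> a \<otimes>\<^bsub>SU2_power\<^esub> q"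
        by (auto simp: double_coset_rel_def)
      then have "a = inv\<^bsub>SU2_power\<^esub> h \<otimes>\<^bsub>SU2_power\<^esub> b \<otimes>\<^bsub>SU2_power\<^esub> inv\<^bsub>SU2_power\<^esub> q"
        by (simp add: P.m_assoc P.inv_solve_left P.inv_solve_right)
      with * show "(b, a) \<in> double_coset_rel"
        unfolding double_coset_rel_def by blast
    qed
    show "trans double_coset_rel"
    proof (rule transI)
      fix a b c assume "(a, b) \<in> double_coset_rel" "(b, c) \<in> double_coset_rel"
      then obtain h q h' q' where *: "a \<in> carrier SU2_power" "c \<in> carrier SU2_power"
          "h \<in> diagonal_SU2" "q \<in> diagonal_SU2" "h' \<in> diagonal_SU2" "q' \<in> diagonal_SU2"
          "c = h' \<otimes>\<^bsub>SU2_power\<^esub> (h \<otimes>\<^bsub>SU2_power\<^esub> a \<otimes>\<^bsub>SU2_power\<^esub> q) \<otimes>\<^bsub>SU2_power\<^esub> q'"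
        by (auto simp: double_coset_rel_def)
      then have "c = (h' \<otimes>\<^bsub>SU2_power\<^esub> h) \<otimes>\<^bsub>SU2_power\<^esub> a \<otimes>\<^bsub>SU2_power\<^esub> (q \<otimes>\<^bsub>SU2_power\<^esub> q')"
        by (simp add: P.m_assoc)
      with * show "(a, c) \<in> double_coset_rel"
        unfolding double_coset_rel_def by blast
    qed
  qed
qed

definition double_cosets :: "('n \<Rightarrow> complex ^ 2 ^ 2) set set" where
  "double_cosets = carrier SU2_power // double_coset_rel"

text \<open>
  Polynomials in commuting variables indexed by \<open>'n\<close> are finitely supported functions from
  exponent vectors to coefficients, with convolution as multiplication.
\<close>

type_synonym 'n cpoly = "('n \<Rightarrow>\<^sub>0 nat) \<Rightarrow>\<^sub>0 complex"

definition poly_var :: "'n \<Rightarrow> 'n cpoly" where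
  "poly_var j = Poly_Mapping.single (Poly_Mapping.single j 1) 1"

definition poly_const :: "complex \<Rightarrow> 'n cpoly" where
  "poly_const c = Poly_Mapping.single 0 c"

definition poly_eval :: "('n::finite) cpoly \<Rightarrow> ('n \<Rightarrow> complex) \<Rightarrow> complex" where
  "poly_eval P x = (\<Sum>m\<in>Poly_Mapping.keys P.
     Poly_Mapping.lookup P m * (\<Prod>j\<in>UNIV. x j ^ Poly_Mapping.lookup m j))"

definition quadratic_forms :: "('n::finite) cpoly set" where
  "quadratic_forms =
     {P. \<forall>m\<in>Poly_Mapping.keys P. (\<Sum>j\<in>UNIV. Poly_Mapping.lookup m j) = 2}"

definition real_coeffs :: "'n cpoly \<Rightarrow> bool" where
  "real_coeffs P \<longleftrightarrow> (\<forall>m. Poly_Mapping.lookup P m \<in> \<real>)"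

definition pos_semidef_form :: "('n::finite) cpoly \<Rightarrow> bool" where
  "pos_semidef_form P \<longleftrightarrow>
     (\<forall>x :: real ^ 'n. poly_eval P (\<lambda>j. complex_of_real (x $ j)) \<in> \<real>\<^sub>\<ge>\<^sub>0)"

text \<open>
  The symmetric matrix of a quadratic form: the coefficient of a mixed monomial is shared
  equally between the two off-diagonal entries.
\<close>

definition form_matrix :: "('n::finite) cpoly \<Rightarrow> complex ^ 'n ^ 'n" where
  "form_matrix P = (\<chi> i j.
     (let c = Poly_Mapping.lookup P (Poly_Mapping.single i 1 + Poly_Mapping.single j 1)
      in if i = j then c else c / 2))"

definition form_rank :: "('n::finite) cpoly \<Rightarrow> nat" where
  "form_rank P = rank (form_matrix P)"

text \<open>
  \<open>det (\<Sum>j. \<lambda>\<^sub>j g\<^sub>j)\<close> with the \<open>\<lambda>\<^sub>j\<close> as indeterminates: a determinant over the polynomial ring.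
\<close>

definition det_form :: "('n::finite \<Rightarrow> complex ^ 2 ^ 2) \<Rightarrow> 'n cpoly" where
  "det_form g = det ((\<chi> r s. \<Sum>j\<in>UNIV. poly_var j * poly_const (g j $ r $ s)) :: 'n cpoly ^ 2 ^ 2)"

end

theory Submission
  imports Defs
begin

text \<open>
  An element of \<open>SU(2)\<close> is determined by its first row \<open>(a, b)\<close>, its second row being
  \<open>(-cnj b, cnj a)\<close>. Polarising the determinant, \<open>Q\<close> becomes the sum of
  \<open>(a\<^sub>j cnj a\<^sub>k + b\<^sub>j cnj b\<^sub>k) \<lambda>\<^sub>j \<lambda>\<^sub>k\<close>, whose symmetric matrix is the Gram matrix of
  the unit vectors \<open>(Re a\<^sub>j, Im a\<^sub>j, Re b\<^sub>j, Im b\<^sub>j)\<close> in four-dimensional Euclidean space.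
\<close>

section \<open>Constants, evaluation and degree-two monomials in the polynomial ring\<close>

lemma poly_const_mult: "poly_const (c * d) = poly_const c * poly_const d"
  by (simp add: poly_const_def mult_single)

lemma poly_const_add: "poly_const (c + d) = poly_const c + poly_const d"
  by (simp add: poly_const_def single_add)

lemma poly_const_diff: "poly_const (c - d) = poly_const c - poly_const d"
  by (simp add: poly_const_def single_diff)

lemma poly_const_1: "poly_const 1 = 1"
  by (simp add: poly_const_def)

text \<open>Terms outside the support have coefficient zero. Enlarging the index set lets
  polynomials with different supports be summed over a common one, which is how additivity of
  evaluation follows.\<close>

lemma poly_eval_eq_sum:
  assumes "finite S" "Poly_Mapping.keys P \<subseteq> S"
  shows "poly_eval P x = (\<Sum>m\<in>S. Poly_Mapping.lookup P m *
           (\<Prod>j\<in>UNIV. x j ^ Poly_Mapping.lookup m j))"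
  unfolding poly_eval_def using assms
  by (intro sum.mono_neutral_left) (auto simp: in_keys_iff)

lemma poly_eval_add: "poly_eval (P + Q) x = poly_eval P x + poly_eval Q x"
proof -
  let ?S = "Poly_Mapping.keys P \<union> Poly_Mapping.keys Q"
  have "Poly_Mapping.keys (P + Q) \<subseteq> ?S"
    by (rule Poly_Mapping.keys_add)
  then show ?thesis
    by (simp add: poly_eval_eq_sum[of ?S] lookup_add sum.distrib algebra_simps)
qed

lemma poly_eval_sum: "poly_eval (\<Sum>i\<in>A. P i) x = (\<Sum>i\<in>A. poly_eval (P i) x)"
  by (induction A rule: infinite_finite_induct) (simp_all add: poly_eval_add, simp_all add: poly_eval_def)

lemma poly_eval_single:
  "poly_eval (Poly_Mapping.single m c) x = c * (\<Prod>j\<in>UNIV. x j ^ Poly_Mapping.lookup m j)"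
  by (simp add: poly_eval_eq_sum[of "{m}"])

lemma prod_power_single:
  fixes x :: "'n::finite \<Rightarrow> 'a::comm_monoid_mult"
  shows "(\<Prod>j\<in>UNIV. x j ^ Poly_Mapping.lookup (Poly_Mapping.single i 1) j) = x i"
proof -
  have "x j ^ Poly_Mapping.lookup (Poly_Mapping.single i 1) j = (if i = j then x j else 1)" for j
    by (simp add: lookup_single when_def)
  then show ?thesis
    by simp
qed

lemma sum_lookup_single:
  "(\<Sum>j\<in>(UNIV::'n::finite set). Poly_Mapping.lookup (Poly_Mapping.single i 1) j) = (1::nat)"
  by (simp add: lookup_single when_def)

text \<open>Comparing the exponent vectors at the four indices involved forces the unordered pairs
  to agree, even when indices coincide. Coefficients of the determinant are read off through this
  criterion.\<close>

lemma single_add_single_eq_iff: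
  "Poly_Mapping.single i (1::nat) + Poly_Mapping.single k 1 =
     Poly_Mapping.single j 1 + Poly_Mapping.single l 1 \<longleftrightarrow>
   i = j \<and> k = l \<or> i = l \<and> k = j" (is "?L = ?R \<longleftrightarrow> _")
proof
  assume eq: "?L = ?R"
  have "Poly_Mapping.lookup ?L m = Poly_Mapping.lookup ?R m" for m
    by (simp only: eq)
  from this[of i] this[of k] this[of j] this[of l]
  show "i = j \<and> k = l \<or> i = l \<and> k = j"
    by (auto simp: lookup_add lookup_single when_def split: if_splits)
qed (auto simp: add.commute)

text \<open>Each row of the product is a linear combination of the rows of \<open>B\<close>, and
  \<open>B\<close> has at most \<open>CARD('k)\<close> distinct rows.\<close>

lemma rank_mul_le_card:
  fixes A :: "'a::field ^ 'k ^ 'm" and B :: "'a ^ 'n ^ 'k"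
  shows "rank (A ** B) \<le> CARD('k)"
proof -
  have "rows (A ** B) \<subseteq> vec.span (rows B)"
  proof
    fix v assume "v \<in> rows (A ** B)"
    then obtain i where "v = row i (A ** B)"
      by (auto simp: rows_def)
    also have "row i (A ** B) = (\<Sum>r\<in>UNIV. A $ i $ r *s row r B)"
      by (simp add: row_def matrix_matrix_mult_def vec_eq_iff)
    also have "\<dots> \<in> vec.span (rows B)"
      by (intro vec.span_sum vec.span_scale vec.span_base) (auto simp: rows_def)
    finally show "v \<in> vec.span (rows B)" .
  qed
  moreover have rows: "rows B = range (\<lambda>r. row r B)"
    by (auto simp: rows_def)
  ultimately have "rank (A ** B) \<le> card (range (\<lambda>r. row r B))"
    unfolding row_rank_def_gen by (intro vec.dim_le_card) auto
  also have "\<dots> \<le> CARD('k)"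
    by (rule card_image_le) simp
  finally show ?thesis .
qed

lemma sum_sum_delta:
  fixes f :: "'a::finite \<Rightarrow> 'b::finite \<Rightarrow> 'c::comm_monoid_add"
  shows "(\<Sum>x\<in>UNIV. \<Sum>y\<in>UNIV. if x = a \<and> y = b then f x y else 0) = f a b"
proof -
  have "(\<Sum>y\<in>UNIV. if x = a \<and> y = b then f x y else 0) = (if x = a then f x b else 0)" for x
    by simp
  then show ?thesis
    by simp
qed

lemma single_one_add_self:
  "Poly_Mapping.single j (1::nat) + Poly_Mapping.single j 1 = Poly_Mapping.single j 2"
  by (simp only: single_add[symmetric] one_add_one)

section \<open>Entries of SU(2) matrices and expansion of the determinant\<close>

lemma SU2_entries:
  assumes "A \<in> carrier SU2"
  shows "A $ 2 $ 2 = cnj (A $ 1 $ 1)" "A $ 2 $ 1 = - cnj (A $ 1 $ 2)"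
    and "A $ 1 $ 1 * cnj (A $ 1 $ 1) + A $ 1 $ 2 * cnj (A $ 1 $ 2) = 1"
proof -
  define a b c d where abcd: "a = A $ 1 $ 1" "b = A $ 1 $ 2" "c = A $ 2 $ 1" "d = A $ 2 $ 2"
  have det: "a * d - b * c = 1" and "A ** conj_transpose A = mat 1"
    using assms by (simp_all add: SU2_def unitary_matrix_def det_2 abcd)
  then have norm: "a * cnj a + b * cnj b = 1" and "c * cnj a + d * cnj b = 0"
    by (simp_all add: vec_eq_iff forall_2 matrix_matrix_mult_def sum_2 conj_transpose_def mat_def abcd)
  \<comment> \<open>The determinant and the orthogonality of the two rows are two linear equations
    in \<open>c\<close> and \<open>d\<close>; the determinant of this system is
    \<open>a * cnj a + b * cnj b\<close>, which is 1, so the solution is unique.\<close>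
  then have "d = cnj a" "c = - cnj b"
    using det by algebra+
  with norm show "A $ 2 $ 2 = cnj (A $ 1 $ 1)" "A $ 2 $ 1 = - cnj (A $ 1 $ 2)"
    and "A $ 1 $ 1 * cnj (A $ 1 $ 1) + A $ 1 $ 2 * cnj (A $ 1 $ 2) = 1"
    by (simp_all add: abcd)
qed

lemma carrier_SU2_power: "g \<in> carrier SU2_power \<longleftrightarrow> (\<forall>j. g j \<in> carrier SU2)"
  by (auto simp: SU2_power_def PiE_UNIV_domain)

text \<open>The 2 by 2 determinant is expanded bilinearly. The sum runs over ordered pairs, so a
  mixed monomial occurs twice and its coefficient is the sum of two contributions.\<close>

lemma det_form_eq_sum:
  "det_form g = (\<Sum>j\<in>UNIV. \<Sum>k\<in>UNIV.
     Poly_Mapping.single (Poly_Mapping.single j 1 + Poly_Mapping.single k 1)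
       (g j $ 1 $ 1 * g k $ 2 $ 2 - g j $ 1 $ 2 * g k $ 2 $ 1))"
proof -
  have "det_form g = (\<Sum>j\<in>UNIV. \<Sum>k\<in>UNIV.
     poly_var j * poly_const (g j $ 1 $ 1) * (poly_var k * poly_const (g k $ 2 $ 2)) -
     poly_var j * poly_const (g j $ 1 $ 2) * (poly_var k * poly_const (g k $ 2 $ 1)))"
    by (simp add: det_form_def det_2 sum_product sum_subtractf)
  also have "\<dots> = (\<Sum>j\<in>UNIV. \<Sum>k\<in>UNIV. poly_var j * poly_var k *
       poly_const (g j $ 1 $ 1 * g k $ 2 $ 2 - g j $ 1 $ 2 * g k $ 2 $ 1))"
    by (simp add: poly_const_mult poly_const_diff algebra_simps)
  finally show ?thesis
    by (simp add: poly_var_def poly_const_def mult_single)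
qed

lemma det_form_in_quadratic_forms: "det_form g \<in> quadratic_forms"
proof -
  have "(\<Sum>j\<in>UNIV. Poly_Mapping.lookup m j) = 2" if "m \<in> Poly_Mapping.keys (det_form g)" for m
  proof -
    from that have "Poly_Mapping.lookup (det_form g) m \<noteq> 0"
      by (simp add: in_keys_iff)
    then obtain j k where "m = Poly_Mapping.single j 1 + Poly_Mapping.single k 1"
      unfolding det_form_eq_sum lookup_sum
      by (auto simp: lookup_single when_def elim!: sum.not_neutral_contains_not_neutral split: if_splits)
    then show ?thesis
      using sum_lookup_single[of j] sum_lookup_single[of k] by (simp add: lookup_add sum.distrib)
  qed
  then show ?thesis
    by (simp add: quadratic_forms_def)
qed

section \<open>Invariance under translation and descent to the double cosets\<close>

lemma det_form_translate:
  fixes g :: "'n::finite \<Rightarrow> complex ^ 2 ^ 2"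
  assumes "det h = 1" "det q = 1"
  shows "det_form (\<lambda>j. h ** g j ** q) = det_form g"
proof -
  \<comment> \<open>With \<open>C\<close> embedding scalar matrices as constant ones and
    \<open>M\<close> forming the matrix of linear forms, translation turns \<open>M g\<close> into
    \<open>C h ** M g ** C q\<close>. The determinant is multiplicative over the polynomial ring,
    and both outer factors have determinant 1.\<close>
  define C where "C A = ((\<chi> r s. poly_const (A $ r $ s)) :: 'n cpoly ^ 2 ^ 2)" for A :: "complex ^ 2 ^ 2"
  define M where "M f = (\<chi> r s. \<Sum>j\<in>UNIV. poly_var j * poly_const (f j $ r $ s))"
    for f :: "'n \<Rightarrow> complex ^ 2 ^ 2"
  have det_C: "det (C A) = poly_const (det A)" for A
    by (simp add: C_def det_2 poly_const_diff poly_const_mult)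
  have "M (\<lambda>j. h ** g j ** q) $ r $ s = (C h ** M g ** C q) $ r $ s" for r s
  proof -
    have "poly_var j * poly_const ((h ** g j ** q) $ r $ s) =
        (\<Sum>t\<in>UNIV. (\<Sum>u\<in>UNIV. poly_const (h $ r $ u) *
          (poly_var j * poly_const (g j $ u $ t))) * poly_const (q $ t $ s))" for j
      by (simp add: matrix_matrix_mult_def sum_2 poly_const_add poly_const_mult
          distrib_left distrib_right mult_ac)
    then have "M (\<lambda>j. h ** g j ** q) $ r $ s = (\<Sum>j\<in>UNIV. \<Sum>t\<in>UNIV.
        (\<Sum>u\<in>UNIV. poly_const (h $ r $ u) *
          (poly_var j * poly_const (g j $ u $ t))) * poly_const (q $ t $ s))"
      by (simp only: M_def vec_lambda_beta)
    also have "\<dots> = (C h ** M g ** C q) $ r $ s"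
      by (simp add: M_def C_def matrix_matrix_mult_def sum_2 sum_distrib_left sum_distrib_right
          sum.distrib distrib_right)
    finally show ?thesis .
  qed
  then have "M (\<lambda>j. h ** g j ** q) = C h ** M g ** C q"
    by (simp add: vec_eq_iff)
  then have "det (M (\<lambda>j. h ** g j ** q)) = det (M g)"
    by (simp add: det_mul det_C assms poly_const_1)
  then show ?thesis
    by (simp add: det_form_def M_def)
qed

lemma det_form_cong:
  assumes "(g, g') \<in> double_coset_rel"
  shows "det_form g = det_form g'"
proof -
  from assms obtain h q where "h \<in> carrier SU2" "q \<in> carrier SU2" "g' = (\<lambda>j. h ** g j ** q)"
    by (auto simp: double_coset_rel_def diagonal_SU2_def SU2_power_def SU2_def restrict_UNIV)
  then show ?thesis
    by (simp add: det_form_translate SU2_def)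
qed

lemma ex1_factor_quotient:
  assumes "equiv A r" "f \<in> A \<rightarrow> B" "\<And>x y. (x, y) \<in> r \<Longrightarrow> f x = f y"
  shows "\<exists>!F. F \<in> (A // r) \<rightarrow>\<^sub>E B \<and> (\<forall>x\<in>A. F (r `` {x}) = f x)"
proof (rule ex_ex1I)
  \<comment> \<open>The value on a class is computed from a chosen representative. Restricting to
    the quotient fixes the value elsewhere, as the extensional function space demands; the same
    convention makes uniqueness hold.\<close>
  define F where "F = restrict (\<lambda>X. f (SOME x. x \<in> X)) (A // r)"
  have F: "F (r `` {x}) = f x" if "x \<in> A" for x
  proof -
    have "x \<in> r `` {x}"
      using assms(1) that by (rule equiv_class_self)
    then have "(SOME y. y \<in> r `` {x}) \<in> r `` {x}"
      by (rule someI)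
    then have "f x = f (SOME y. y \<in> r `` {x})"
      using assms(3) by blast
    with that show ?thesis
      by (simp add: F_def quotientI)
  qed
  moreover have "F \<in> (A // r) \<rightarrow>\<^sub>E B"
  proof (rule PiE_I)
    fix X assume "X \<in> A // r"
    then show "F X \<in> B"
      using F assms(2) by (auto elim!: quotientE)
  qed (simp add: F_def)
  ultimately show "\<exists>F. F \<in> (A // r) \<rightarrow>\<^sub>E B \<and> (\<forall>x\<in>A. F (r `` {x}) = f x)"
    by blast
next
  fix F G
  assume F: "F \<in> (A // r) \<rightarrow>\<^sub>E B \<and> (\<forall>x\<in>A. F (r `` {x}) = f x)"
    and G: "G \<in> (A // r) \<rightarrow>\<^sub>E B \<and> (\<forall>x\<in>A. G (r `` {x}) = f x)"
  show "F = G"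
  proof (rule PiE_ext)
    fix X assume "X \<in> A // r"
    then show "F X = G X"
      using F G by (auto elim!: quotientE)
  qed (rule conjunct1[OF F] conjunct1[OF G])+
qed

section \<open>Coefficients, positivity and rank for a tuple in SU(2)\<close>

context
  fixes g :: "'n::finite \<Rightarrow> complex ^ 2 ^ 2"
  assumes g: "g \<in> carrier SU2_power"
begin

text \<open>Once the second rows are eliminated, the contribution of a pair is the Hermitian inner
  product of the first rows of \<open>g j\<close> and \<open>g k\<close>.\<close>

lemma det_form_SU2:
  "det_form g = (\<Sum>j\<in>UNIV. \<Sum>k\<in>UNIV.
     Poly_Mapping.single (Poly_Mapping.single j 1 + Poly_Mapping.single k 1)
       (g j $ 1 $ 1 * cnj (g k $ 1 $ 1) + g j $ 1 $ 2 * cnj (g k $ 1 $ 2)))"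
  using g by (simp add: det_form_eq_sum carrier_SU2_power SU2_entries)

lemma lookup_det_form_square: "Poly_Mapping.lookup (det_form g) (Poly_Mapping.single j 2) = 1"
proof -
  have eq: "Poly_Mapping.single j 2 = Poly_Mapping.single j (1::nat) + Poly_Mapping.single j 1"
    by (rule single_one_add_self[symmetric])
  have "Poly_Mapping.lookup (det_form g) (Poly_Mapping.single j 2) =
      g j $ 1 $ 1 * cnj (g j $ 1 $ 1) + g j $ 1 $ 2 * cnj (g j $ 1 $ 2)"
    unfolding det_form_SU2 lookup_sum eq lookup_single single_add_single_eq_iff
    by (simp add: when_def sum_sum_delta)
  also have "\<dots> = 1"
    using g by (intro SU2_entries(3)) (simp add: carrier_SU2_power)
  finally show ?thesis .
qed

lemma lookup_det_form_mixed:
  assumes "i \<noteq> k"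
  shows "Poly_Mapping.lookup (det_form g) (Poly_Mapping.single i 1 + Poly_Mapping.single k 1) =
     complex_of_real (2 * Re (g i $ 1 $ 1 * cnj (g k $ 1 $ 1) + g i $ 1 $ 2 * cnj (g k $ 1 $ 2)))"
proof -
  define B where "B j l = g j $ 1 $ 1 * cnj (g l $ 1 $ 1) + g j $ 1 $ 2 * cnj (g l $ 1 $ 2)" for j l
  have "Poly_Mapping.lookup (det_form g) (Poly_Mapping.single i 1 + Poly_Mapping.single k 1) =
      (\<Sum>j\<in>UNIV. \<Sum>l\<in>UNIV. if j = i \<and> l = k \<or> l = i \<and> j = k then B j l else 0)"
    unfolding det_form_SU2 lookup_sum lookup_single single_add_single_eq_iff
    by (intro sum.cong refl) (auto simp: when_def B_def)
  \<comment> \<open>Since \<open>i\<close> and \<open>k\<close> differ, the two index conditions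
    exclude each other and the conditional splits into a sum. The two surviving terms are complex
    conjugates, hence the doubled real part.\<close>
  also have "\<dots> = (\<Sum>j\<in>UNIV. \<Sum>l\<in>UNIV.
      (if j = i \<and> l = k then B j l else 0) + (if j = k \<and> l = i then B j l else 0))"
    using assms by (intro sum.cong) auto
  also have "\<dots> = B i k + B k i"
    by (simp only: sum.distrib sum_sum_delta)
  also have "B k i = cnj (B i k)"
    by (simp add: B_def mult.commute)
  finally show ?thesis
    by (simp add: B_def complex_eq_iff)
qed

lemma real_coeffs_det_form: "real_coeffs (det_form g)"
  unfolding real_coeffs_def
proof
  fix m
  show "Poly_Mapping.lookup (det_form g) m \<in> \<real>"
  proof (cases "\<exists>j k. m = Poly_Mapping.single j 1 + Poly_Mapping.single k 1")
    case True
    then obtain j k where m: "m = Poly_Mapping.single j 1 + Poly_Mapping.single k 1"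
      by blast
    show ?thesis
    proof (cases "j = k")
      case True
      then have "m = Poly_Mapping.single j 2"
        by (simp only: m single_one_add_self)
      then show ?thesis
        by (simp add: lookup_det_form_square)
    next
      case False
      then show ?thesis
        unfolding m lookup_det_form_mixed[OF False] by (intro Reals_of_real)
    qed
  next
    case False
    \<comment> \<open>A monomial that is not a product of two variables matches no summand, so its
      coefficient is zero.\<close>
    then show ?thesis
      by (auto simp: det_form_SU2 lookup_sum lookup_single when_def intro!: sum_in_Reals) blast
  qed
qed

lemma pos_semidef_det_form: "pos_semidef_form (det_form g)"
  unfolding pos_semidef_form_def
proof
  fix x :: "real ^ 'n"
  \<comment> \<open>The pair \<open>(a, b)\<close> is the first row of the real combination of the
    \<open>g j\<close> with weights \<open>x\<close>. For real weights conjugation passes through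
    the sums, so the value of the form is the squared norm of this row.\<close>
  define a where "a = (\<Sum>j\<in>UNIV. complex_of_real (x $ j) * g j $ 1 $ 1)"
  define b where "b = (\<Sum>j\<in>UNIV. complex_of_real (x $ j) * g j $ 1 $ 2)"
  have "poly_eval (det_form g) (\<lambda>j. complex_of_real (x $ j)) = a * cnj a + b * cnj b"
    by (simp add: det_form_SU2 poly_eval_sum poly_eval_single lookup_add power_add prod.distrib
        prod_power_single[simplified] a_def b_def sum_product sum.distrib[symmetric] algebra_simps)
  also have "\<dots> = complex_of_real ((cmod a)\<^sup>2 + (cmod b)\<^sup>2)"
    by (simp only: complex_norm_square of_real_add)
  also have "\<dots> \<in> \<real>\<^sub>\<ge>\<^sub>0"
    by (simp only: nonneg_Reals_of_real_iff) simp
  finally show "poly_eval (det_form g) (\<lambda>j. complex_of_real (x $ j)) \<in> \<real>\<^sub>\<ge>\<^sub>0" .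
qed

lemma form_rank_det_form_le: "form_rank (det_form g) \<le> 4"
proof -
  \<comment> \<open>Splitting into real coordinates makes the real part of the Hermitian product a
    plain dot product, so \<open>transpose\<close> suffices and the form matrix factors through
    dimension four.\<close>
  define V :: "complex ^ 4 ^ 'n" where
    "V = (\<chi> j r. complex_of_real
       (if r = 1 then Re (g j $ 1 $ 1) else if r = 2 then Im (g j $ 1 $ 1)
        else if r = 3 then Re (g j $ 1 $ 2) else Im (g j $ 1 $ 2)))"
  have "form_matrix (det_form g) $ i $ k = (V ** transpose V) $ i $ k" for i k
  proof -
    have "(V ** transpose V) $ i $ k =
        complex_of_real (Re (g i $ 1 $ 1 * cnj (g k $ 1 $ 1) + g i $ 1 $ 2 * cnj (g k $ 1 $ 2)))"
      by (simp add: V_def matrix_matrix_mult_def transpose_def sum_4)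
    moreover have "form_matrix (det_form g) $ i $ k =
        complex_of_real (Re (g i $ 1 $ 1 * cnj (g k $ 1 $ 1) + g i $ 1 $ 2 * cnj (g k $ 1 $ 2)))"
    \<comment> \<open>The form matrix halves only off-diagonal coefficients: the factor 2 of a mixed
      coefficient cancels, while a diagonal entry is already the squared norm 1.\<close>
    proof (cases "i = k")
      case True
      have "form_matrix (det_form g) $ i $ k = 1"
        using True
        by (simp only: form_matrix_def Let_def vec_lambda_beta single_one_add_self
            lookup_det_form_square refl if_True)
      moreover have "g k $ 1 $ 1 * cnj (g k $ 1 $ 1) + g k $ 1 $ 2 * cnj (g k $ 1 $ 2) = 1"
        using g by (intro SU2_entries(3)) (simp add: carrier_SU2_power)
      ultimately show ?thesis
        using True by (simp only: one_complex.sel of_real_1)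
    next
      case False
      then show ?thesis
        using lookup_det_form_mixed[OF False] by (simp add: form_matrix_def Let_def)
    qed
    ultimately show ?thesis
      by simp
  qed
  then have "form_matrix (det_form g) = V ** transpose V"
    by (simp add: vec_eq_iff)
  then show ?thesis
    unfolding form_rank_def using rank_mul_le_card[of V "transpose V"] by simp
qed

end

theorem proposition2p1:
  shows "(\<exists>!F. F \<in> (double_cosets :: ('n::finite \<Rightarrow> complex ^ 2 ^ 2) set set) \<rightarrow>\<^sub>E quadratic_forms \<and>
            (\<forall>g\<in>carrier SU2_power. F (double_coset_rel `` {g}) = det_form g)) \<and>
         (\<forall>g\<in>carrier (SU2_power :: ('n \<Rightarrow> complex ^ 2 ^ 2) monoid).
            real_coeffs (det_form g) \<and>
            (\<forall>j. Poly_Mapping.lookup (det_form g) (Poly_Mapping.single j 2) = 1) \<and>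
            pos_semidef_form (det_form g) \<and>
            form_rank (det_form g) \<le> 4)"
proof (intro conjI ballI allI)
  show "\<exists>!F. F \<in> (double_cosets :: ('n \<Rightarrow> complex ^ 2 ^ 2) set set) \<rightarrow>\<^sub>E quadratic_forms \<and>
      (\<forall>g\<in>carrier SU2_power. F (double_coset_rel `` {g}) = det_form g)"
    unfolding double_cosets_def
    by (intro ex1_factor_quotient equiv_double_coset_rel)
      (auto simp: det_form_in_quadratic_forms det_form_cong)
qed (simp_all add: real_coeffs_det_form lookup_det_form_square pos_semidef_det_form
    form_rank_det_form_le)

end
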